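(* Let $n$ be a nonnegative integer. There is a chain $\mathcal{F}_0 \subsetneq \mathcal{F}_1 \subsetneq \cdots \subsetneq \mathcal{F}_{2^n}$ of convex families of subsets of $[n]$ such that $|\mathcal{F}_m|=m$ and $|(\mathcal{F}_m)^{\updownarrow}|=\Phi(n,m)$ for each $m \in \{0,\ldots,2^{n}\}$. Furthermore, this chain includes the families $\mathcal{C}_{n,a}$ and $\mathcal{C}^*_{n,a}$ for each $a \in \{0,\ldots,n-2\}$ with $a \equiv n \pmod{2}$, where \begin{align*} \mathcal{C}_{n,a} & = \{A \subseteq [n]:[\tfrac{n-a}{2}] \subseteq A \subseteq [\tfrac{n+a}{2}]\}, \\ \mathcal{C}^*_{n,a} &= \{A \subseteq [n]: A \nsubseteq \{\tfrac{n-a}{2}+1,\ldots,n\} \text{ and } \{\tfrac{n+a}{2}+1,\ldots,n\} \nsubseteq A\}. \end{align*}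
   Context: For a nonnegative integer $n$, $[n]=\{1,\ldots,n\}$ (so $[0]=\emptyset$), and $2^X$ denotes the power set of a set $X$. For a family $\mathcal{F}$ of subsets of $[n]$, let $\mathcal{F}^{\downarrow}=\{S \subseteq [n]: S \subseteq F \text{ for some } F \in \mathcal{F}\}$, $\mathcal{F}^{\uparrow}=\{S \subseteq [n]: F \subseteq S \text{ for some } F \in \mathcal{F}\}$ and $\mathcal{F}^{\updownarrow}=\mathcal{F}^{\uparrow}\cup\mathcal{F}^{\downarrow}$. The family $\mathcal{F}$ is convex if $\mathcal{F}^{\uparrow}\cap\mathcal{F}^{\downarrow}=\mathcal{F}$. For nonnegative integers $m,n$ with $m \leq 2^n$, let $\Phi(n,m)=\min\{|\mathcal{F}^{\updownarrow}|: \mathcal{F}\subseteq 2^{[n]},\ |\mathcal{F}|=m\}$. *)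

theory Defs
  imports "HOL-Number_Theory.Cong"
begin

text \<open>The ground set $[n]$ is the set \<open>{1..n}\<close> of natural numbers; a family of
  subsets of $[n]$ is a set \<open>F \<subseteq> Pow {1..n}\<close>.\<close>

definition downset :: "nat \<Rightarrow> nat set set \<Rightarrow> nat set set" where
  "downset n F = {S. S \<subseteq> {1..n} \<and> (\<exists>A\<in>F. S \<subseteq> A)}"

definition upset :: "nat \<Rightarrow> nat set set \<Rightarrow> nat set set" where
  "upset n F = {S. S \<subseteq> {1..n} \<and> (\<exists>A\<in>F. A \<subseteq> S)}"

definition updownset :: "nat \<Rightarrow> nat set set \<Rightarrow> nat set set" where
  "updownset n F = upset n F \<union> downset n F"

definition convex_family :: "nat \<Rightarrow> nat set set \<Rightarrow> bool" where
  "convex_family n F \<longleftrightarrow> upset n F \<inter> downset n F = F"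

text \<open>\<open>Phi n m\<close> is meaningful only for \<open>m \<le> 2 ^ n\<close>; otherwise the set of which the
  minimum is taken is empty.\<close>

definition Phi :: "nat \<Rightarrow> nat \<Rightarrow> nat" where
  "Phi n m = Min {card (updownset n F) | F. F \<subseteq> Pow {1..n} \<and> card F = m}"

text \<open>The families $\mathcal{C}_{n,a}$ and $\mathcal{C}^*_{n,a}$ are only used for \<open>a \<le> n\<close>
  of the same parity as \<open>n\<close>, so that natural-number subtraction and division by 2 are
  exact.\<close>

definition C_fam :: "nat \<Rightarrow> nat \<Rightarrow> nat set set" where
  "C_fam n a = {A. A \<subseteq> {1..n} \<and> {1..(n - a) div 2} \<subseteq> A \<and> A \<subseteq> {1..(n + a) div 2}}"

definition C_star_fam :: "nat \<Rightarrow> nat \<Rightarrow> nat set set" where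
  "C_star_fam n a = {A. A \<subseteq> {1..n} \<and> \<not> A \<subseteq> {(n - a) div 2 + 1..n}
                        \<and> \<not> {(n + a) div 2 + 1..n} \<subseteq> A}"

end

theory Submission
  imports Defs
begin

text \<open>
  For a convex family \<open>F\<close> with up-closure \<open>U\<close> and down-closure \<open>D\<close> one has
  \<open>F = U \<inter> D\<close> and \<open>card (updownset n F) + card F = card U + card D\<close>. Minimising the number of
  sets comparable to \<open>F\<close> is thus the same as minimising \<open>card U + card D\<close> over up-sets \<open>U\<close> and
  down-sets \<open>D\<close> with \<open>card (U \<inter> D) \<ge> m\<close>.

  The lower bound is a sharpening, for given cardinalities, of Kleitman's inequality
  \<open>2 ^ n * card (U \<inter> D) \<le> card U * card D\<close>: among up-sets of size \<open>u\<close> and down-sets of size \<open>d\<close> the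
  intersection is at most as large as for the last \<open>u\<close> sets in the lexicographic order and the
  first \<open>d\<close> sets in the lexicographic order that reads the elements backwards. The size
  \<open>lexmeet n u d\<close> of this model intersection obeys a simple recursion. The inequality
  (\<open>card_upset_Int_downset_le\<close>) follows by splitting on one element, since the numerical function
  is superadditive on oppositely ordered pairs (\<open>lexmeet_superadditive\<close>).

  Two properties of \<open>lexmeet\<close> then pass optimality from \<open>n\<close> to \<open>n + 2\<close>. Let \<open>N = 2 ^ (n + 2)\<close>.
  \<^item> Halving (\<open>lexmeet_halve\<close>): for \<open>m \<le> 2 ^ n\<close> the least \<open>u + d\<close> with \<open>lexmeet (n + 2) u d \<ge> m\<close> is
    at least twice the least such sum for \<open>n\<close>. An optimal family \<open>F\<close> for \<open>n\<close> gives an optimal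
    family for \<open>n + 2\<close>: add one new element to every member of \<open>F\<close> and leave another new element
    out of all of them (\<open>lift\<close>); this doubles both closures.
  \<^item> Complementation (\<open>lexmeet_complement\<close>): replacing \<open>(u, d)\<close> by \<open>(N - u, N - d)\<close> replaces the
    intersection by the set outside the union. So optimal families of more than \<open>2 ^ n\<close> sets
    arise from small ones: the sets incomparable to a lifted family form an optimal family
    (\<open>colift\<close>), and so does every family between two consecutive families of this kind.

  The lifts of an optimal flag for \<open>n\<close>, with the new elements placed at the two ends of the ground
  set, increase; the colifts, for the reflected placement, decrease; and every lift is contained in
  every colift. Together they form a chain of convex families, which extends to a chain
  containing a convex family of every size (\<open>flag_through_chain\<close>), and all its members are
  optimal. The lift of \<open>C_fam n a\<close> is \<open>C_fam (n + 2) a\<close> and its colift is \<open>C_star_fam (n + 2) a\<close>,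
  which places these families in the chain.
\<close>

section \<open>The lexicographic overlap function\<close>

text \<open>
  For \<open>u, d \<le> 2 ^ n\<close> this is the number of 0-1 words of length \<open>n\<close> that are among the last \<open>u\<close> in
  the lexicographic order and among the first \<open>d\<close> in the lexicographic order of the reversed words.
  The recursion splits on the first letter: it is the most significant one for the first order,
  which fills the half with letter 1 before the other, and the least significant one for the second
  order, which distributes \<open>d\<close> as evenly as possible, favouring letter 0. In the base case both
  arguments are meant to be at most 1; \<open>min\<close>, unlike the product, is 1-Lipschitz for all arguments.
\<close>
fun lexmeet :: "nat \<Rightarrow> nat \<Rightarrow> nat \<Rightarrow> nat" where
  "lexmeet 0 u d = min u d"
| "lexmeet (Suc n) u d = lexmeet n (min u (2 ^ n)) (d div 2) + lexmeet n (u - 2 ^ n) ((d + 1) div 2)"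

declare lexmeet.simps(2) [simp del]

lemma lexmeet_le: "lexmeet n u d \<le> u"
proof (induction n arbitrary: u d)
  case (Suc n)
  show ?case using add_mono[OF Suc.IH[of "min u (2 ^ n)" "d div 2"] Suc.IH[of "u - 2 ^ n" "(d + 1) div 2"]]
    by (auto simp: lexmeet.simps(2) min_def split: if_splits)
qed simp

lemma lexmeet_0 [simp]: "lexmeet n 0 d = 0"
  using lexmeet_le[of n 0 d] by simp

lemma lexmeet_mono: "u \<le> u' \<Longrightarrow> d \<le> d' \<Longrightarrow> lexmeet n u d \<le> lexmeet n u' d'"
  by (induction n arbitrary: u u' d d') (auto intro!: add_mono simp: lexmeet.simps(2) min_le_iff_disj div_le_mono)

lemma floor_ceil: "x div 2 + (x + 1) div 2 = (x :: nat)"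
  by simp

lemma lexmeet_Lipschitz: "d \<le> d' \<Longrightarrow> lexmeet n u d' \<le> lexmeet n u d + (d' - d)"
proof (induction n arbitrary: u d d')
  case (Suc n)
  let ?x = "d' div 2 - d div 2" and ?y = "(d' + 1) div 2 - (d + 1) div 2"
  have "lexmeet (Suc n) u d' \<le> (lexmeet n (min u (2 ^ n)) (d div 2) + ?x)
      + (lexmeet n (u - 2 ^ n) ((d + 1) div 2) + ?y)"
    unfolding lexmeet.simps using Suc.prems by (intro add_mono Suc.IH div_le_mono add_right_mono)
  also have "\<dots> = lexmeet (Suc n) u d + (?x + ?y)"
    unfolding lexmeet.simps by (simp only: add_ac)
  also have "?x + ?y = (d' div 2 + (d' + 1) div 2) - (d div 2 + (d + 1) div 2)"
  proof -
    have "(a' - a) + (b' - b) = (a' + b') - (a + b)" if "a \<le> a'" "b \<le> b'" for a b a' b' :: nat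
      using that by simp
    then show ?thesis using Suc.prems by (simp add: div_le_mono)
  qed
  also have "\<dots> = d' - d" using floor_ceil by simp
  finally show ?case .
qed simp

lemma lexmeet_full: "d \<le> 2 ^ n \<Longrightarrow> lexmeet n (2 ^ n) d = d"
proof (induction n arbitrary: d)
  case (Suc n)
  have "d div 2 \<le> 2 ^ n" "(d + 1) div 2 \<le> 2 ^ n" using Suc.prems by auto
  then show ?case using Suc.IH by (simp add: lexmeet.simps(2))
qed simp

lemma lexmeet_low: "u \<le> 2 ^ n \<Longrightarrow> lexmeet (Suc n) u d = lexmeet n u (d div 2)"
  by (simp add: lexmeet.simps(2) min_def)

lemma lexmeet_high: "2 ^ n \<le> u \<Longrightarrow> d \<le> 2 ^ Suc n \<Longrightarrow>
    lexmeet (Suc n) u d = d div 2 + lexmeet n (u - 2 ^ n) ((d + 1) div 2)"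
  by (simp add: lexmeet.simps(2) min_def lexmeet_full)

text \<open>
  Complementing all letters reverses both orders, so the left-hand overlap counts the words
  outside both of the sets that are counted on the right.
\<close>
lemma lexmeet_complement:
  "u \<le> 2 ^ n \<Longrightarrow> d \<le> 2 ^ n \<Longrightarrow>
    lexmeet n (2 ^ n - u) (2 ^ n - d) + u + d = 2 ^ n + lexmeet n u d"
proof (induction n arbitrary: u d)
  case 0
  then show ?case by (cases "u = 0"; cases "d = 0") auto
next
  case (Suc n)
  let ?H = "2 ^ n :: nat"
  have e: "min (2 ^ Suc n - u) ?H = ?H - (u - ?H)" "2 ^ Suc n - u - ?H = ?H - min u ?H"
    "(2 ^ Suc n - d) div 2 = ?H - (d + 1) div 2" "(2 ^ Suc n - d + 1) div 2 = ?H - d div 2"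
    using Suc.prems by auto
  have "lexmeet n (?H - (u - ?H)) (?H - (d + 1) div 2) + (u - ?H) + (d + 1) div 2
      = ?H + lexmeet n (u - ?H) ((d + 1) div 2)"
    using Suc.prems by (intro Suc.IH) auto
  moreover have "lexmeet n (?H - min u ?H) (?H - d div 2) + min u ?H + d div 2
      = ?H + lexmeet n (min u ?H) (d div 2)"
    using Suc.prems by (intro Suc.IH) auto
  moreover have "(u - ?H) + min u ?H = u" "(d + 1) div 2 + d div 2 = d" "2 ^ Suc n = ?H + ?H" by auto
  ultimately show ?case unfolding lexmeet.simps e by linarith
qed

text \<open>
  The recursion on the other argument, which splits on the last letter.
\<close>
lemma lexmeet_Suc_right:
  "u \<le> 2 ^ Suc n \<Longrightarrow> d \<le> 2 ^ Suc n \<Longrightarrow>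
    lexmeet (Suc n) u d = lexmeet n (u div 2) (min d (2 ^ n)) + lexmeet n ((u + 1) div 2) (d - 2 ^ n)"
proof (induction n arbitrary: u d)
  case 0
  then have "u \<in> {0,1,2}" "d \<in> {0,1,2}" by auto
  then show ?case by (auto simp: lexmeet.simps(2))
next
  case (Suc n)
  let ?H = "2 ^ n :: nat"
  have b: "min u (2 ^ Suc n) \<le> 2 ^ Suc n" "u - 2 ^ Suc n \<le> 2 ^ Suc n"
     "d div 2 \<le> 2 ^ Suc n" "(d + 1) div 2 \<le> 2 ^ Suc n" using Suc.prems by auto
  have e: "min (x div 2) ?H = min x (2 ^ Suc n) div 2" "x div 2 - ?H = (x - 2 ^ Suc n) div 2"
    "min ((x + 1) div 2) ?H = (min x (2 ^ Suc n) + 1) div 2"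
    "(x + 1) div 2 - ?H = (x - 2 ^ Suc n + 1) div 2" for x :: nat
    by (auto simp: min_def)
  show ?case
    unfolding lexmeet.simps(2)[of "Suc n" u d] Suc.IH[OF b(1,3)] Suc.IH[OF b(2,4)]
    unfolding lexmeet.simps(2)[of n "u div 2"] lexmeet.simps(2)[of n "(u + 1) div 2"]
    unfolding e(3,4) unfolding e(1,2) by (simp only: add_ac)
qed

lemma lexmeet_commute: "u \<le> 2 ^ n \<Longrightarrow> d \<le> 2 ^ n \<Longrightarrow> lexmeet n u d = lexmeet n d u"
proof (induction n arbitrary: u d)
  case (Suc n)
  have "lexmeet n (u div 2) (min d (2 ^ n)) = lexmeet n (min d (2 ^ n)) (u div 2)"
    "lexmeet n ((u + 1) div 2) (d - 2 ^ n) = lexmeet n (d - 2 ^ n) ((u + 1) div 2)"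
    using Suc.prems by (auto intro!: Suc.IH)
  then show ?case using lexmeet_Suc_right[OF Suc.prems] by (simp add: lexmeet.simps(2)[of n d])
qed simp

text \<open>
  The numerical core of the lower bound. By complementation \<open>u0 + u1\<close> may be assumed to be at most
  half of the range, so that the right-hand side loses one level of the recursion. If \<open>u1\<close> is also
  small, both terms on the left lose a level and the induction hypothesis applies directly.
  Otherwise \<open>u1\<close> fills one half; the terms of the other half are compared after moving both second
  arguments to the common value \<open>z\<close>, and the cost of this move is covered by the full half, because
  \<open>lexmeet\<close> is 1-Lipschitz. For equal second arguments the induction hypothesis says that \<open>lexmeet\<close> is
  superadditive in its first argument.
\<close>
lemma lexmeet_superadditive:
  "u0 \<le> u1 \<Longrightarrow> u1 \<le> 2 ^ n \<Longrightarrow> d1 \<le> d0 \<Longrightarrow> d0 \<le> 2 ^ n \<Longrightarrow>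
    lexmeet n u0 d0 + lexmeet n u1 d1 \<le> lexmeet (Suc n) (u0 + u1) (d0 + d1)"
proof (induction n arbitrary: u0 u1 d0 d1)
  case 0
  then have "(u0, u1) \<in> {(0,0),(0,1),(1,1)}" "(d1, d0) \<in> {(0,0),(0,1),(1,1)}" by auto
  then show ?case by (auto simp: lexmeet.simps(2))
next
  case (Suc n)
  let ?H = "2 ^ n :: nat" and ?K = "2 ^ Suc n :: nat"
  have small: "lexmeet (Suc n) u0 d0 + lexmeet (Suc n) u1 d1 \<le> lexmeet (Suc (Suc n)) (u0 + u1) (d0 + d1)"
    if u: "u0 \<le> u1" "u0 + u1 \<le> ?K" and d: "d1 \<le> d0" "d0 \<le> ?K" for u0 u1 d0 d1
  proof -
    define c where "c = (d0 + d1) div 2"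
    have c: "d1 \<le> c" "c \<le> ?K" using d by (auto simp: c_def)
    have rhs: "lexmeet (Suc (Suc n)) (u0 + u1) (d0 + d1) = lexmeet (Suc n) (u0 + u1) c"
      unfolding c_def using u by (intro lexmeet_low)
    have u0: "lexmeet (Suc n) u0 d0 = lexmeet n u0 (d0 div 2)" using u by (intro lexmeet_low) simp
    show ?thesis
    proof (cases "u1 \<le> ?H")
      case True
      have "lexmeet n u0 (d0 div 2) + lexmeet n u1 (d1 div 2)
          \<le> lexmeet (Suc n) (u0 + u1) (d0 div 2 + d1 div 2)"
        using u d True by (intro Suc.IH) auto
      also have "\<dots> \<le> lexmeet (Suc n) (u0 + u1) c"
        unfolding c_def by (intro lexmeet_mono) auto
      finally show ?thesis using lexmeet_low[OF True] by (simp only: rhs u0)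
    next
      case False
      define z where "z = (c + 1) div 2"
      have z: "z \<le> ?H" using c by (simp add: z_def)
      have sub: "lexmeet n a z + lexmeet n b z \<le> lexmeet n (a + b) z" if "a + b \<le> ?H" for a b
      proof -
        have "lexmeet n (min a b) z + lexmeet n (max a b) z \<le> lexmeet (Suc n) (min a b + max a b) (z + z)"
          using that z by (intro Suc.IH) auto
        also have "\<dots> = lexmeet n (a + b) z"
          using that by (subst lexmeet_low) (auto simp: min_def max_def add.commute)
        finally show ?thesis by (auto simp: min_def max_def add.commute split: if_splits)
      qed
      have "lexmeet n u0 (d0 div 2) \<le> lexmeet n u0 z + (d0 div 2 - z)"
        using lexmeet_Lipschitz[of z "d0 div 2" n u0] lexmeet_mono[of u0 u0 "d0 div 2" z n]
        by (cases "z \<le> d0 div 2") auto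
      moreover have "lexmeet n (u1 - ?H) ((d1 + 1) div 2) \<le> lexmeet n (u1 - ?H) z"
        using c(1) unfolding z_def by (intro lexmeet_mono) auto
      moreover have "lexmeet n u0 z + lexmeet n (u1 - ?H) z \<le> lexmeet n (u0 + u1 - ?H) z"
        using sub[of u0 "u1 - ?H"] u False by simp
      moreover have "d1 div 2 + (d0 div 2 - z) \<le> c div 2"
      proof (cases "d0 div 2 \<le> z")
        case True
        then show ?thesis using c(1) by (simp add: div_le_mono)
      next
        case False
        have "d1 div 2 + d0 div 2 \<le> c" unfolding c_def by linarith
        moreover have "z + c div 2 = c" unfolding z_def by linarith
        ultimately show ?thesis using False by linarith
      qed
      moreover have "lexmeet (Suc n) u1 d1 = d1 div 2 + lexmeet n (u1 - ?H) ((d1 + 1) div 2)"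
        using False d by (intro lexmeet_high) auto
      moreover have "lexmeet (Suc n) (u0 + u1) c = c div 2 + lexmeet n (u0 + u1 - ?H) z"
        unfolding z_def using False c by (intro lexmeet_high) auto
      ultimately show ?thesis unfolding rhs u0 by linarith
    qed
  qed
  show ?case
  proof (cases "u0 + u1 \<le> ?K")
    case True
    then show ?thesis using small Suc.prems by blast
  next
    case False
    have K: "2 ^ Suc (Suc n) = ?K + ?K" by simp
    have e: "?K - u1 + (?K - u0) = 2 ^ Suc (Suc n) - (u0 + u1)"
      "?K - d1 + (?K - d0) = 2 ^ Suc (Suc n) - (d0 + d1)"
      unfolding K using Suc.prems by linarith+
    have "lexmeet (Suc n) (?K - u1) (?K - d1) + lexmeet (Suc n) (?K - u0) (?K - d0)
        \<le> lexmeet (Suc (Suc n)) (2 ^ Suc (Suc n) - (u0 + u1)) (2 ^ Suc (Suc n) - (d0 + d1))"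
      unfolding e[symmetric] using Suc.prems False by (intro small) auto
    moreover have "lexmeet (Suc n) (?K - u0) (?K - d0) + u0 + d0 = ?K + lexmeet (Suc n) u0 d0"
      "lexmeet (Suc n) (?K - u1) (?K - d1) + u1 + d1 = ?K + lexmeet (Suc n) u1 d1"
      by (rule lexmeet_complement; use Suc.prems in linarith)+
    moreover have "lexmeet (Suc (Suc n)) (2 ^ Suc (Suc n) - (u0 + u1)) (2 ^ Suc (Suc n) - (d0 + d1))
        + (u0 + u1) + (d0 + d1) = 2 ^ Suc (Suc n) + lexmeet (Suc (Suc n)) (u0 + u1) (d0 + d1)"
      using Suc.prems by (intro lexmeet_complement) auto
    ultimately show ?thesis using K by linarith
  qed
qed

text \<open>
  If both arguments are at most half of the range, one step of each of the two recursions halves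
  both of them. If \<open>u\<close> exceeds half of the range but \<open>u + d\<close> stays below the range, two steps turn the
  overlap into \<open>d div 2\<close> plus an overlap that is at most \<open>u div 2 - 2 ^ n\<close>; this is no more than what
  the whole cube and a down-set of size \<open>u div 2 + d div 2 - 2 ^ n\<close> have in common. If \<open>u + d\<close> is at
  least the range, the whole cube serves as both sets.
\<close>
lemma lexmeet_halve:
  assumes "m \<le> 2 ^ n" "m \<le> lexmeet (Suc (Suc n)) u d" "u \<le> 2 ^ Suc (Suc n)" "d \<le> 2 ^ Suc (Suc n)"
  shows "\<exists>u' d'. u' \<le> 2 ^ n \<and> d' \<le> 2 ^ n \<and> m \<le> lexmeet n u' d' \<and> 2 * (u' + d') \<le> u + d"
proof -
  let ?Q = "2 ^ n :: nat"
  have big: "\<exists>u' d'. u' \<le> ?Q \<and> d' \<le> ?Q \<and> m \<le> lexmeet n u' d' \<and> 2 * (u' + d') \<le> u + d"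
    if "m \<le> lexmeet (Suc (Suc n)) u d" "d \<le> u" "2 * ?Q < u" "u + d < 4 * ?Q" for u d
  proof -
    define v where "v = u div 2"
    have v: "?Q \<le> v" "v \<le> 2 * ?Q" using that(3,4) unfolding v_def by linarith+
    have "lexmeet (Suc (Suc n)) u d = lexmeet (Suc (Suc n)) d u"
      using that by (intro lexmeet_commute) auto
    also have "\<dots> = lexmeet (Suc n) d v" unfolding v_def using that by (intro lexmeet_low) auto
    also have "\<dots> = lexmeet (Suc n) v d" using that v by (intro lexmeet_commute) auto
    also have "\<dots> = d div 2 + lexmeet n (v - ?Q) ((d + 1) div 2)"
      using that v by (intro lexmeet_high) auto
    also have "\<dots> \<le> d div 2 + (v - ?Q)" using lexmeet_le by simp
    finally have m: "m + ?Q \<le> v + d div 2" using v that(1) by linarith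
    define d' where "d' = v + d div 2 - ?Q"
    have sum: "?Q + d' = v + d div 2" using v(1) by (simp add: d'_def)
    have "2 * v \<le> u" "2 * (d div 2) \<le> d" unfolding v_def by simp_all
    then have le: "2 * (?Q + d') \<le> u + d" unfolding sum add_mult_distrib2 by (rule add_mono)
    then have d': "d' \<le> ?Q" using that(4) by simp
    then have "m \<le> lexmeet n ?Q d'" using m sum by (simp add: lexmeet_full)
    then show ?thesis using le d' by blast
  qed
  consider "4 * ?Q \<le> u + d" | "u \<le> 2 * ?Q" "d \<le> 2 * ?Q" | "d \<le> u" "2 * ?Q < u" "u + d < 4 * ?Q"
    | "u \<le> d" "2 * ?Q < d" "d + u < 4 * ?Q"
    by (metis add.commute le_less_trans linorder_le_cases not_le)
  then show ?thesis
  proof cases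
    case 1
    then show ?thesis using assms(1) by (intro exI[of _ ?Q]) (simp add: lexmeet_full)
  next
    case 2
    have "lexmeet (Suc (Suc n)) u d = lexmeet (Suc n) u (d div 2)"
      using 2 by (intro lexmeet_low) simp
    also have "\<dots> = lexmeet (Suc n) (d div 2) u" using 2 by (intro lexmeet_commute) auto
    also have "\<dots> = lexmeet n (d div 2) (u div 2)" using 2 by (intro lexmeet_low) simp
    finally show ?thesis using assms(2) 2 by (intro exI[of _ "d div 2"] exI[of _ "u div 2"]) auto
  next
    case 3
    then show ?thesis using big assms(2) by blast
  next
    case 4
    have "lexmeet (Suc (Suc n)) u d = lexmeet (Suc (Suc n)) d u"
      using assms by (intro lexmeet_commute)
    then show ?thesis using big[of d u] 4 assms(2) by (simp add: add.commute)
  qed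
qed

section \<open>Up-sets, down-sets and convex families\<close>

lemma upset_subset: "upset n F \<subseteq> Pow {1..n}" and downset_subset: "downset n F \<subseteq> Pow {1..n}"
  by (auto simp: upset_def downset_def)

lemma finite_upset [simp]: "finite (upset n F)"
  by (rule finite_subset[of _ "Pow {1..n}"]) (auto simp: upset_def)

lemma finite_downset [simp]: "finite (downset n F)"
  by (rule finite_subset[of _ "Pow {1..n}"]) (auto simp: downset_def)

lemma subset_upset_Int_downset: "F \<subseteq> Pow {1..n} \<Longrightarrow> F \<subseteq> upset n F \<inter> downset n F"
  by (auto simp: upset_def downset_def)

lemma updownset_mono: "F \<subseteq> G \<Longrightarrow> updownset n F \<subseteq> updownset n G"
  by (auto simp: updownset_def upset_def downset_def)

lemma finite_updownset [simp]: "finite (updownset n F)"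
  by (simp add: updownset_def)

lemma updownset_subset: "updownset n F \<subseteq> Pow {1..n}"
  unfolding updownset_def using upset_subset downset_subset by blast

lemma card_updownset:
  "card (updownset n F) + card (upset n F \<inter> downset n F) = card (upset n F) + card (downset n F)"
  unfolding updownset_def by (rule card_Un_Int[symmetric]) simp_all

lemma card_updownset_convex:
  "convex_family n F \<Longrightarrow> card (updownset n F) + card F = card (upset n F) + card (downset n F)"
  using card_updownset[of n F] by (simp add: convex_family_def)

lemma convex_family_iff:
  assumes "F \<subseteq> Pow {1..n}"
  shows "convex_family n F \<longleftrightarrow> (\<forall>A\<in>F. \<forall>C\<in>F. \<forall>B. A \<subseteq> B \<and> B \<subseteq> C \<longrightarrow> B \<in> F)"
proof -
  have "convex_family n F \<longleftrightarrow> upset n F \<inter> downset n F \<subseteq> F"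
    using subset_upset_Int_downset[OF assms] by (auto simp: convex_family_def)
  also have "\<dots> \<longleftrightarrow> (\<forall>A\<in>F. \<forall>C\<in>F. \<forall>B. B \<subseteq> {1..n} \<and> A \<subseteq> B \<and> B \<subseteq> C \<longrightarrow> B \<in> F)"
    by (auto simp: upset_def downset_def subset_iff[of "_ \<inter> _"])
  also have "\<dots> \<longleftrightarrow> (\<forall>A\<in>F. \<forall>C\<in>F. \<forall>B. A \<subseteq> B \<and> B \<subseteq> C \<longrightarrow> B \<in> F)"
    using assms by (meson PowD in_mono order_trans)
  finally show ?thesis .
qed

lemma convex_family_incomparable: "convex_family n (Pow {1..n} - updownset n F)"
proof (subst convex_family_iff)
  show "\<forall>A\<in>Pow {1..n} - updownset n F. \<forall>C\<in>Pow {1..n} - updownset n F.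
      \<forall>B. A \<subseteq> B \<and> B \<subseteq> C \<longrightarrow> B \<in> Pow {1..n} - updownset n F"
  proof (intro ballI allI impI)
    fix A C B assume "A \<in> Pow {1..n} - updownset n F" "C \<in> Pow {1..n} - updownset n F"
      and B: "A \<subseteq> B \<and> B \<subseteq> C"
    then have A: "A \<subseteq> {1..n}" "A \<notin> downset n F" and C: "C \<subseteq> {1..n}" "C \<notin> upset n F"
      by (auto simp: updownset_def)
    have "B \<notin> downset n F" using A order_trans[OF conjunct1[OF B]] by (auto simp: downset_def)
    moreover have "B \<notin> upset n F" using C order_trans[OF _ conjunct2[OF B]] by (auto simp: upset_def)
    moreover have "B \<subseteq> {1..n}" using B C by blast
    ultimately show "B \<in> Pow {1..n} - updownset n F" by (simp add: updownset_def)
  qed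
qed simp

text \<open>
  The two sections of a family at the element \<open>n + 1\<close>, named as for simplicial complexes.
\<close>
definition deletion :: "nat \<Rightarrow> nat set set \<Rightarrow> nat set set" where
  "deletion n F = {A. A \<subseteq> {1..n} \<and> A \<in> F}"
definition link :: "nat \<Rightarrow> nat set set \<Rightarrow> nat set set" where
  "link n F = {A. A \<subseteq> {1..n} \<and> insert (Suc n) A \<in> F}"

lemma card_deletion_link:
  assumes "F \<subseteq> Pow {1..Suc n}"
  shows "card (deletion n F) + card (link n F) = card F"
proof -
  have fin: "finite (deletion n F)" "finite (link n F)"
    by (rule finite_subset[of _ "Pow {1..n}"]; auto simp: deletion_def link_def)+
  have split: "F = deletion n F \<union> insert (Suc n) ` link n F"
  proof
    show "F \<subseteq> deletion n F \<union> insert (Suc n) ` link n F"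
    proof
      fix A assume A: "A \<in> F"
      then have s: "A - {Suc n} \<subseteq> {1..n}" using assms by (auto simp: atLeastAtMostSuc_conv)
      show "A \<in> deletion n F \<union> insert (Suc n) ` link n F"
      proof (cases "Suc n \<in> A")
        case True
        then have "insert (Suc n) (A - {Suc n}) = A" by auto
        then show ?thesis using A s by (auto simp: link_def intro!: image_eqI[of _ _ "A - {Suc n}"])
      qed (use A s in \<open>auto simp: deletion_def\<close>)
    qed
  qed (auto simp: deletion_def link_def)
  have disj: "deletion n F \<inter> insert (Suc n) ` link n F = {}"
    by (auto simp: deletion_def)
  have inj: "inj_on (insert (Suc n)) (link n F)"
  proof (rule inj_onI)
    fix A B assume "A \<in> link n F" "B \<in> link n F" "insert (Suc n) A = insert (Suc n) B"
    moreover from this have "Suc n \<notin> A" "Suc n \<notin> B" by (auto simp: link_def)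
    ultimately show "A = B" by (simp add: insert_ident)
  qed
  have "card (deletion n F \<union> insert (Suc n) ` link n F) = card (deletion n F) + card (link n F)"
    using fin disj inj by (simp add: card_Un_disjoint card_image)
  then show ?thesis using split by simp
qed

lemma card_Pow_le: "F \<subseteq> Pow {1..n} \<Longrightarrow> card F \<le> 2 ^ n"
  using card_mono[of "Pow {1..n}" F] by (simp add: card_Pow)

text \<open>
  Split both families on the last element. For an up-set the link contains the deletion, and for a
  down-set it is contained in it: the two sections are oppositely ordered by size, as
  \<open>lexmeet_superadditive\<close> demands.
\<close>
lemma card_upset_Int_downset_le:
  "upset n U = U \<Longrightarrow> downset n D = D \<Longrightarrow> card (U \<inter> D) \<le> lexmeet n (card U) (card D)"
proof (induction n arbitrary: U D)
  case 0
  have "upset 0 U \<subseteq> {{}}" "downset 0 D \<subseteq> {{}}" by (auto simp: upset_def downset_def)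
  then have "U \<subseteq> {{}}" "D \<subseteq> {{}}" using 0 by simp_all
  then have "U \<in> {{}, {{}}}" "D \<in> {{}, {{}}}" by auto
  then show ?case by auto
next
  case (Suc n)
  note up = Suc.prems(1) and down = Suc.prems(2)
  have upD: "B \<in> U" if "A \<in> U" "A \<subseteq> B" "B \<subseteq> {1..Suc n}" for A B
    using that up unfolding upset_def by blast
  have downD: "A \<in> D" if "B \<in> D" "A \<subseteq> B" for A B
    using that down unfolding downset_def by blast
  have sub: "U \<subseteq> Pow {1..Suc n}" "D \<subseteq> Pow {1..Suc n}"
    using upset_subset[of "Suc n" U] downset_subset[of "Suc n" D] up down by simp_all
  have ins: "insert (Suc n) A \<subseteq> {1..Suc n}" if "A \<subseteq> {1..n}" for A
    using that by auto
  have u: "upset n (deletion n U) = deletion n U"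
  proof (intro equalityI subsetI)
    fix S assume "S \<in> upset n (deletion n U)"
    then obtain A where "S \<subseteq> {1..n}" "A \<in> U" "A \<subseteq> S" by (auto simp: upset_def deletion_def)
    then show "S \<in> deletion n U" using upD[of A S] by (fastforce simp: deletion_def)
  qed (auto simp: upset_def deletion_def)
  have u': "upset n (link n U) = link n U"
  proof (intro equalityI subsetI)
    fix S assume "S \<in> upset n (link n U)"
    then obtain A where A: "S \<subseteq> {1..n}" "insert (Suc n) A \<in> U" "A \<subseteq> S"
      by (auto simp: upset_def link_def)
    then show "S \<in> link n U"
      using upD[OF A(2) insert_mono[OF A(3)] ins[OF A(1)]] by (simp add: link_def)
  qed (auto simp: upset_def link_def)
  have d: "downset n (deletion n D) = deletion n D"
  proof (intro equalityI subsetI)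
    fix S assume "S \<in> downset n (deletion n D)"
    then obtain A where "S \<subseteq> {1..n}" "A \<in> D" "S \<subseteq> A" by (auto simp: downset_def deletion_def)
    then show "S \<in> deletion n D" using downD[of A S] by (simp add: deletion_def)
  qed (auto simp: downset_def deletion_def)
  have d': "downset n (link n D) = link n D"
  proof (intro equalityI subsetI)
    fix S assume "S \<in> downset n (link n D)"
    then obtain A where A: "S \<subseteq> {1..n}" "insert (Suc n) A \<in> D" "S \<subseteq> A"
      by (auto simp: downset_def link_def)
    then show "S \<in> link n D"
      using downD[OF A(2) insert_mono[OF A(3)]] by (simp add: link_def)
  qed (auto simp: downset_def link_def)
  have sections: "deletion n F \<subseteq> Pow {1..n}" "link n F \<subseteq> Pow {1..n}" for F
    by (auto simp: deletion_def link_def)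
  have "card (U \<inter> D) = card (deletion n U \<inter> deletion n D) + card (link n U \<inter> link n D)"
  proof -
    have "deletion n (U \<inter> D) = deletion n U \<inter> deletion n D" "link n (U \<inter> D) = link n U \<inter> link n D"
      by (auto simp: deletion_def link_def)
    moreover have "U \<inter> D \<subseteq> Pow {1..Suc n}" using sub by blast
    ultimately show ?thesis using card_deletion_link[of "U \<inter> D" n] by simp
  qed
  also have "\<dots> \<le> lexmeet n (card (deletion n U)) (card (deletion n D))
      + lexmeet n (card (link n U)) (card (link n D))"
    using Suc.IH u u' d d' by (intro add_mono)
  also have "\<dots> \<le> lexmeet (Suc n) (card (deletion n U) + card (link n U))
      (card (deletion n D) + card (link n D))"
  proof (rule lexmeet_superadditive)
    show "card (deletion n U) \<le> card (link n U)"
    proof (rule card_mono[OF finite_subset[OF sections(2)]])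
      show "deletion n U \<subseteq> link n U"
      proof
        fix A assume "A \<in> deletion n U"
        then have "A \<in> U" "A \<subseteq> {1..n}" by (simp_all add: deletion_def)
        then show "A \<in> link n U" using upD[OF _ subset_insertI ins] by (simp add: link_def)
      qed
    qed simp
    show "card (link n D) \<le> card (deletion n D)"
      by (rule card_mono[OF finite_subset[OF sections(1)]])
        (use downD[OF _ subset_insertI] in \<open>auto simp: deletion_def link_def\<close>)
  qed (use sections card_Pow_le in auto)
  finally show ?case using card_deletion_link sub by simp
qed

text \<open>
  A maximal chain in the lattice of convex families, indexed by cardinality.
\<close>
definition flag :: "nat \<Rightarrow> (nat \<Rightarrow> nat set set) \<Rightarrow> bool" where
  "flag n F \<longleftrightarrow>
     (\<forall>m \<le> 2 ^ n. F m \<subseteq> Pow {1..n} \<and> convex_family n (F m) \<and> card (F m) = m) \<and>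
     (\<forall>m < 2 ^ n. F m \<subset> F (Suc m))"

lemma flag_mono:
  assumes "flag n F" "i \<le> j" "j \<le> 2 ^ n"
  shows "F i \<subseteq> F j"
  using assms(2,3)
proof (induction j rule: dec_induct)
  case (step k)
  then have "F k \<subset> F (Suc k)" using assms(1) by (simp add: flag_def)
  then show ?case using step by auto
qed simp

text \<open>
  Between nested convex families one can pass by adding a single set at a time. A minimal new set
  above some member of \<open>A\<close> works, as everything in between lies in \<open>B\<close> and is excluded from being new by
  minimality; if there is none, use a maximal new set below some member; if there is none either,
  every new set is incomparable to all of \<open>A\<close>.
\<close>
lemma convex_family_insert:
  assumes A: "convex_family n A" and B: "convex_family n B" "A \<subset> B" "B \<subseteq> Pow {1..n}"
  shows "\<exists>x\<in>B - A. convex_family n (insert x A)"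
proof -
  have finB: "finite B" using B(3) by (rule finite_subset) simp
  have "A \<subseteq> Pow {1..n}" using B by blast
  note cA = A[unfolded convex_family_iff[OF this], rule_format]
    and cB = B(1)[unfolded convex_family_iff[OF B(3)], rule_format]
  have crit: ?thesis
    if x: "x \<in> B - A" and up: "\<And>X Y. X \<in> A \<Longrightarrow> X \<subseteq> Y \<Longrightarrow> Y \<subseteq> x \<Longrightarrow> Y \<in> insert x A"
      and down: "\<And>X Y. X \<in> A \<Longrightarrow> x \<subseteq> Y \<Longrightarrow> Y \<subseteq> X \<Longrightarrow> Y \<in> insert x A" for x
  proof (rule bexI[OF _ x])
    have "insert x A \<subseteq> Pow {1..n}" using x B by blast
    then show "convex_family n (insert x A)"
      unfolding convex_family_iff[OF \<open>insert x A \<subseteq> Pow {1..n}\<close>]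
    proof (intro ballI allI impI)
      fix X Z Y assume "X \<in> insert x A" "Z \<in> insert x A" and Y: "X \<subseteq> Y \<and> Y \<subseteq> Z"
      then consider "X = x" "Z = x" | "X \<in> A" "Z = x" | "X = x" "Z \<in> A" | "X \<in> A" "Z \<in> A" by blast
      then show "Y \<in> insert x A"
      proof cases
        case 1
        then show ?thesis using Y by blast
      next
        case 2
        then show ?thesis using Y up by blast
      next
        case 3
        then show ?thesis using Y down by blast
      next
        case 4
        then show ?thesis using Y cA by blast
      qed
    qed
  qed
  let ?P = "{x \<in> B - A. \<exists>a\<in>A. a \<subseteq> x}" and ?N = "{x \<in> B - A. \<exists>a\<in>A. x \<subseteq> a}"
  show ?thesis
  proof (cases "?P = {}")
    case False
    have "finite ?P" using finB by simp
    from finite_has_minimal[OF this False]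
    obtain x where x: "x \<in> ?P" "\<forall>y\<in>?P. y \<subseteq> x \<longrightarrow> x = y" by (rule bexE)
    show ?thesis
    proof (rule crit)
      show "x \<in> B - A" using x by blast
      show "Y \<in> insert x A" if "X \<in> A" "X \<subseteq> Y" "Y \<subseteq> x" for X Y
      proof -
        have "Y \<in> B" using cB[of X x Y] that x(1) B(2) by blast
        then show ?thesis using x that by blast
      qed
      show "Y \<in> insert x A" if "X \<in> A" "x \<subseteq> Y" "Y \<subseteq> X" for X Y
      proof -
        obtain a where "a \<in> A" "a \<subseteq> x" using x by blast
        then have "Y \<in> A" using cA[of a X Y] that by blast
        then show ?thesis by blast
      qed
    qed
  next
    case P: True
    show ?thesis
    proof (cases "?N = {}")
      case False
      have "finite ?N" using finB by simp
      from finite_has_maximal[OF this False]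
      obtain x where x: "x \<in> ?N" "\<forall>y\<in>?N. x \<subseteq> y \<longrightarrow> x = y" by (rule bexE)
      show ?thesis
      proof (rule crit)
        show "x \<in> B - A" using x by blast
        show "Y \<in> insert x A" if "X \<in> A" "x \<subseteq> Y" "Y \<subseteq> X" for X Y
        proof -
          have "Y \<in> B" using cB[of x X Y] that x(1) B(2) by blast
          then show ?thesis using x that by blast
        qed
        show "Y \<in> insert x A" if "X \<in> A" "X \<subseteq> Y" "Y \<subseteq> x" for X Y
          using P x that by blast
      qed
    next
      case True
      obtain x where "x \<in> B - A" using B by blast
      then show ?thesis using crit[of x] P True by blast
    qed
  qed
qed

text \<open>
  Take a maximal chain \<open>T\<close> of convex families that contains \<open>S\<close>. It contains a family of every
  cardinality, since otherwise \<open>convex_family_insert\<close> would refine it at a gap.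
\<close>
lemma flag_through_chain:
  assumes conv: "\<And>X. X \<in> S \<Longrightarrow> X \<subseteq> Pow {1..n} \<and> convex_family n X"
    and chain: "\<And>X Y. X \<in> S \<Longrightarrow> Y \<in> S \<Longrightarrow> X \<subseteq> Y \<or> Y \<subseteq> X"
  shows "\<exists>F. flag n F \<and> (\<forall>X\<in>S. F (card X) = X)"
proof -
  define good where "good T \<longleftrightarrow> S \<subseteq> T \<and> (\<forall>X\<in>T. X \<subseteq> Pow {1..n} \<and> convex_family n X)
     \<and> (\<forall>X\<in>T. \<forall>Y\<in>T. X \<subseteq> Y \<or> Y \<subseteq> X)" for T
  have "{T. good T} \<subseteq> Pow (Pow (Pow {1..n}))" by (auto simp: good_def)
  then have "finite {T. good T}" by (rule finite_subset) simp
  moreover have "good S" using assms by (simp add: good_def)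
  ultimately obtain T where T: "good T" and maxi: "\<And>T'. good T' \<Longrightarrow> T \<subseteq> T' \<Longrightarrow> T' = T"
    using finite_has_maximal[of "{T. good T}"] by auto
  have inS: "S \<subseteq> T" using T by (simp add: good_def)
  have inT': "X \<subseteq> Pow {1..n} \<and> convex_family n X" if "X \<in> T" for X
    using T that by (simp add: good_def)
  have cmp: "X \<subseteq> Y \<or> Y \<subseteq> X" if "X \<in> T" "Y \<in> T" for X Y
    using T that by (simp add: good_def)
  have insT: "Z \<in> T" if "Z \<subseteq> Pow {1..n}" "convex_family n Z" "\<And>W. W \<in> T \<Longrightarrow> W \<subseteq> Z \<or> Z \<subseteq> W" for Z
  proof -
    have "good (insert Z T)"
      unfolding good_def
    proof (intro conjI ballI)
      show "S \<subseteq> insert Z T" using inS by blast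
      show "X \<subseteq> Pow {1..n}" "convex_family n X" if "X \<in> insert Z T" for X
        using that \<open>Z \<subseteq> Pow {1..n}\<close> \<open>convex_family n Z\<close> inT' by auto
      show "X \<subseteq> Y \<or> Y \<subseteq> X" if "X \<in> insert Z T" "Y \<in> insert Z T" for X Y
        using that cmp \<open>\<And>W. W \<in> T \<Longrightarrow> W \<subseteq> Z \<or> Z \<subseteq> W\<close> by (elim insertE) auto
    qed
    then show ?thesis using maxi by blast
  qed
  have inT: "X \<subseteq> Pow {1..n}" "finite X" "convex_family n X" if "X \<in> T" for X
    using inT'[OF that] finite_subset[of X "Pow {1..n}"] by auto
  have le: "X \<subseteq> Y" if "X \<in> T" "Y \<in> T" "card X \<le> card Y" for X Y
  proof -
    consider "X \<subseteq> Y" | "Y \<subseteq> X" using cmp \<open>X \<in> T\<close> \<open>Y \<in> T\<close> by blast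
    then show ?thesis
    proof cases
      case 2
      then show ?thesis using card_seteq[OF inT(2) 2] that by simp
    qed
  qed
  have top: "Pow {1..n} \<in> T"
    using inT by (intro insT) (auto simp: convex_family_iff)
  have ex: "\<exists>X\<in>T. card X = m" if "m \<le> 2 ^ n" for m
    using that
  proof (induction m)
    case 0
    have "{} \<in> T" by (rule insT) (auto simp: convex_family_iff)
    then show ?case using card.empty by blast
  next
    case (Suc m)
    then obtain X where X: "X \<in> T" "card X = m" by auto
    have "Pow {1..n} \<in> T \<and> m < card (Pow {1..n})" using top Suc.prems by (simp add: card_Pow)
    from ex_has_least_nat[of "\<lambda>Y. Y \<in> T \<and> m < card Y", OF this, of card]
    obtain Y where Y: "Y \<in> T" "m < card Y" and least: "\<And>W. W \<in> T \<Longrightarrow> m < card W \<Longrightarrow> card Y \<le> card W" by blast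
    have "X \<subset> Y" using le[OF X(1) Y(1)] X Y by auto
    then obtain x where x: "x \<in> Y - X" "convex_family n (insert x X)"
      using convex_family_insert[OF inT(3)[OF X(1)] inT(3)[OF Y(1)] _ inT(1)[OF Y(1)]] by blast
    have "insert x X \<in> T"
    proof (rule insT)
      show "insert x X \<subseteq> Pow {1..n}" using x inT[OF X(1)] inT[OF Y(1)] by blast
      show "W \<subseteq> insert x X \<or> insert x X \<subseteq> W" if "W \<in> T" for W
      proof (cases "m < card W")
        case True
        then have "Y \<subseteq> W" using le[OF Y(1) that] least that by blast
        then show ?thesis using x \<open>X \<subset> Y\<close> by blast
      next
        case False
        then have "W \<subseteq> X" using le[OF that X(1)] X by simp
        then show ?thesis by blast
      qed
    qed (use x in auto)
    moreover have "card (insert x X) = Suc m" using x X inT by simp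
    ultimately show ?case by blast
  qed
  define F where "F m = (SOME X. X \<in> T \<and> card X = m)" for m
  have F: "F m \<in> T" "card (F m) = m" if "m \<le> 2 ^ n" for m
    using someI_ex[of "\<lambda>X. X \<in> T \<and> card X = m"] ex[OF that] unfolding F_def by blast+
  have "F (card X) = X" if "X \<in> S" for X
  proof -
    have "X \<in> T" using inS that by blast
    have m: "card X \<le> 2 ^ n" by (rule card_Pow_le[OF conjunct1[OF conv[OF that]]])
    show ?thesis using le[OF F(1)[OF m] \<open>X \<in> T\<close>] le[OF \<open>X \<in> T\<close> F(1)[OF m]] F(2)[OF m] by simp
  qed
  moreover have "flag n F"
    unfolding flag_def
  proof (intro conjI allI impI)
    fix m :: nat assume m: "m < 2 ^ n"
    then have "F m \<subseteq> F (Suc m)" using F by (intro le) auto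
    moreover have "card (F m) \<noteq> card (F (Suc m))" using F(2)[of m] F(2)[of "Suc m"] m by simp
    ultimately show "F m \<subset> F (Suc m)" by auto
  next
    fix m :: nat assume m: "m \<le> 2 ^ n"
    show "F m \<subseteq> Pow {1..n}" "convex_family n (F m)" "card (F m) = m"
      using inT[OF F(1)[OF m]] F(2)[OF m] by simp_all
  qed
  ultimately show ?thesis by blast
qed

section \<open>Adding two elements to the ground set\<close>

text \<open>
  The ground set \<open>{1..n + 2}\<close> consists of a relabelled copy of \<open>{1..n}\<close> and two new elements \<open>p\<close> and \<open>q\<close>.
  The relabelling is kept general because two different ones are needed later.
\<close>
locale two_new_points =
  fixes n :: nat and p q :: nat and \<pi> :: "nat \<Rightarrow> nat"
  assumes inj: "inj_on \<pi> {1..n}"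
    and new: "p \<noteq> q" "p \<notin> \<pi> ` {1..n}" "q \<notin> \<pi> ` {1..n}"
    and ground: "{1..Suc (Suc n)} = insert p (insert q (\<pi> ` {1..n}))"
begin

definition trace :: "nat set \<Rightarrow> nat set" where
  "trace S = {x \<in> {1..n}. \<pi> x \<in> S}"

text \<open>
  The cube over \<open>{1..n + 2}\<close> splits into four copies of the cube over \<open>{1..n}\<close>, according to whether
  \<open>p\<close> and \<open>q\<close> are present; this is a copy of \<open>F\<close> in one of them.
\<close>
definition block :: "bool \<Rightarrow> bool \<Rightarrow> nat set set \<Rightarrow> nat set set" where
  "block b c F = {S. S \<subseteq> {1..Suc (Suc n)} \<and> (p \<in> S) = b \<and> (q \<in> S) = c \<and> trace S \<in> F}"

abbreviation lift :: "nat set set \<Rightarrow> nat set set" where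
  "lift F \<equiv> block True False F"

lemma trace_subset: "trace S \<subseteq> {1..n}"
  by (auto simp: trace_def)

lemma trace_image:
  assumes "A \<subseteq> {1..n}" "N \<subseteq> {p, q}"
  shows "trace (N \<union> \<pi> ` A) = A"
proof -
  have "\<pi> x \<in> N \<union> \<pi> ` A \<longleftrightarrow> x \<in> A" if "x \<in> {1..n}" for x
  proof -
    have "\<pi> x \<notin> N" using that assms(2) new(2,3) by blast
    then show ?thesis using inj_on_image_mem_iff[OF inj that assms(1)] by simp
  qed
  then show ?thesis using assms(1) by (auto simp: trace_def)
qed

lemma subset_iff_trace:
  assumes "S \<subseteq> {1..Suc (Suc n)}"
  shows "S \<subseteq> T \<longleftrightarrow> (p \<in> S \<longrightarrow> p \<in> T) \<and> (q \<in> S \<longrightarrow> q \<in> T) \<and> trace S \<subseteq> trace T"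
proof
  assume R: "(p \<in> S \<longrightarrow> p \<in> T) \<and> (q \<in> S \<longrightarrow> q \<in> T) \<and> trace S \<subseteq> trace T"
  show "S \<subseteq> T"
  proof
    fix x assume x: "x \<in> S"
    then have "x \<in> insert p (insert q (\<pi> ` {1..n}))" using assms unfolding ground by blast
    then consider "x = p" | "x = q" | y where "y \<in> {1..n}" "x = \<pi> y" by blast
    then show "x \<in> T"
    proof cases
      case 3
      then have "y \<in> trace S" using x by (simp add: trace_def)
      then have "y \<in> trace T" using R by blast
      then show ?thesis using 3 by (simp add: trace_def)
    qed (use x R in auto)
  qed
qed (auto simp: trace_def)

lemma block_subset: "block b c F \<subseteq> Pow {1..Suc (Suc n)}"
  by (auto simp: block_def)

lemma block_member:
  assumes "A \<subseteq> {1..n}"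
  shows "\<exists>S. S \<subseteq> {1..Suc (Suc n)} \<and> (p \<in> S) = b \<and> (q \<in> S) = c \<and> trace S = A"
proof (intro exI conjI)
  let ?N = "(if b then {p} else {}) \<union> (if c then {q} else {})"
  show "?N \<union> \<pi> ` A \<subseteq> {1..Suc (Suc n)}" using assms unfolding ground by auto
  show "(p \<in> ?N \<union> \<pi> ` A) = b" "(q \<in> ?N \<union> \<pi> ` A) = c" using new assms by auto
  show "trace (?N \<union> \<pi> ` A) = A" by (rule trace_image) (use assms in auto)
qed

lemma card_block:
  assumes "F \<subseteq> Pow {1..n}"
  shows "card (block b c F) = card F"
proof (rule bij_betw_same_card[of trace])
  show "bij_betw trace (block b c F) F"
    unfolding bij_betw_def
  proof
    show "inj_on trace (block b c F)"
    proof (rule inj_onI)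
      fix S T assume S: "S \<in> block b c F" and T: "T \<in> block b c F" and eq: "trace S = trace T"
      have sub: "S \<subseteq> {1..Suc (Suc n)}" "T \<subseteq> {1..Suc (Suc n)}"
        using S T unfolding block_def by blast+
      have same: "p \<in> S \<longleftrightarrow> p \<in> T" "q \<in> S \<longleftrightarrow> q \<in> T"
        using S T unfolding block_def by blast+
      show "S = T"
        unfolding set_eq_subset subset_iff_trace[OF sub(1)] subset_iff_trace[OF sub(2)]
        using same eq by blast
    qed
    show "trace ` block b c F = F"
    proof
      show "F \<subseteq> trace ` block b c F"
      proof
        fix A assume A: "A \<in> F"
        then obtain S where "S \<subseteq> {1..Suc (Suc n)}" "(p \<in> S) = b" "(q \<in> S) = c" "trace S = A"
          using block_member[of A b c] assms by auto
        then show "A \<in> trace ` block b c F" using A by (auto simp: block_def)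
      qed
    qed (auto simp: block_def)
  qed
qed

text \<open>
  Going up from a set that contains \<open>p\<close> but not \<open>q\<close> keeps \<open>p\<close> and makes \<open>q\<close> optional. Dually for
  going down, where \<open>q\<close> stays absent and \<open>p\<close> becomes optional. So each closure occupies two of the
  four blocks.
\<close>
lemma upset_lift:
  assumes "F \<subseteq> Pow {1..n}"
  shows "upset (Suc (Suc n)) (lift F) = block True False (upset n F) \<union> block True True (upset n F)"
proof
  show "upset (Suc (Suc n)) (lift F) \<subseteq> block True False (upset n F) \<union> block True True (upset n F)"
  proof
    fix S assume "S \<in> upset (Suc (Suc n)) (lift F)"
    then obtain T where S: "S \<subseteq> {1..Suc (Suc n)}" and T: "T \<in> lift F" "T \<subseteq> S" by (auto simp: upset_def)
    then have "p \<in> S" "trace T \<in> F" "trace T \<subseteq> trace S" using subset_iff_trace[of T S]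
      by (simp_all add: block_def)
    then have "trace S \<in> upset n F" using trace_subset unfolding upset_def by blast
    then show "S \<in> block True False (upset n F) \<union> block True True (upset n F)"
      using S \<open>p \<in> S\<close> by (simp add: block_def)
  qed
  show "block True False (upset n F) \<union> block True True (upset n F) \<subseteq> upset (Suc (Suc n)) (lift F)"
  proof
    fix S assume "S \<in> block True False (upset n F) \<union> block True True (upset n F)"
    then have S: "S \<subseteq> {1..Suc (Suc n)}" "p \<in> S" "trace S \<in> upset n F" by (auto simp: block_def)
    then obtain A where A: "A \<in> F" "A \<subseteq> trace S" by (auto simp: upset_def)
    obtain T where T: "T \<subseteq> {1..Suc (Suc n)}" "(p \<in> T) = True" "(q \<in> T) = False" "trace T = A"
      using block_member[of A True False] assms A by blast
    then have "T \<in> lift F" "T \<subseteq> S" using A S T subset_iff_trace[of T S] by (simp_all add: block_def)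
    then show "S \<in> upset (Suc (Suc n)) (lift F)" using S(1) unfolding upset_def by blast
  qed
qed

lemma downset_lift:
  assumes "F \<subseteq> Pow {1..n}"
  shows "downset (Suc (Suc n)) (lift F) = block True False (downset n F) \<union> block False False (downset n F)"
proof
  show "downset (Suc (Suc n)) (lift F) \<subseteq> block True False (downset n F) \<union> block False False (downset n F)"
  proof
    fix S assume "S \<in> downset (Suc (Suc n)) (lift F)"
    then obtain T where S: "S \<subseteq> {1..Suc (Suc n)}" and T: "T \<in> lift F" "S \<subseteq> T" by (auto simp: downset_def)
    then have "q \<notin> S" "trace T \<in> F" "trace S \<subseteq> trace T" using subset_iff_trace[of S T]
      by (auto simp: block_def)
    then have "trace S \<in> downset n F" using trace_subset unfolding downset_def by blast
    then show "S \<in> block True False (downset n F) \<union> block False False (downset n F)"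
      using S \<open>q \<notin> S\<close> by (simp add: block_def)
  qed
  show "block True False (downset n F) \<union> block False False (downset n F) \<subseteq> downset (Suc (Suc n)) (lift F)"
  proof
    fix S assume "S \<in> block True False (downset n F) \<union> block False False (downset n F)"
    then have S: "S \<subseteq> {1..Suc (Suc n)}" "q \<notin> S" "trace S \<in> downset n F" by (auto simp: block_def)
    then obtain A where A: "A \<in> F" "trace S \<subseteq> A" by (auto simp: downset_def)
    obtain T where T: "T \<subseteq> {1..Suc (Suc n)}" "(p \<in> T) = True" "(q \<in> T) = False" "trace T = A"
      using block_member[of A True False] assms A by blast
    then have "T \<in> lift F" "S \<subseteq> T" using A S T subset_iff_trace[of S T] by (simp_all add: block_def)
    then show "S \<in> downset (Suc (Suc n)) (lift F)" using S(1) unfolding downset_def by blast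
  qed
qed

lemma convex_lift:
  assumes "F \<subseteq> Pow {1..n}" "convex_family n F"
  shows "convex_family (Suc (Suc n)) (lift F)"
proof -
  have "upset (Suc (Suc n)) (lift F) \<inter> downset (Suc (Suc n)) (lift F) = lift (upset n F \<inter> downset n F)"
    unfolding upset_lift[OF assms(1)] downset_lift[OF assms(1)] by (auto simp: block_def)
  then show ?thesis using assms(2) by (simp add: convex_family_def)
qed

lemma finite_block: "finite (block b c F)"
  by (rule finite_subset[OF block_subset]) simp

lemma card_updownset_lift:
  assumes "F \<subseteq> Pow {1..n}"
  shows "card (upset (Suc (Suc n)) (lift F)) = 2 * card (upset n F)"
    and "card (downset (Suc (Suc n)) (lift F)) = 2 * card (downset n F)"
proof -
  have "block True False G \<inter> block b b G = {}" for b G by (auto simp: block_def)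
  then show "card (upset (Suc (Suc n)) (lift F)) = 2 * card (upset n F)"
    "card (downset (Suc (Suc n)) (lift F)) = 2 * card (downset n F)"
    unfolding upset_lift[OF assms] downset_lift[OF assms]
    by (simp_all add: card_Un_disjoint finite_block card_block[OF upset_subset] card_block[OF downset_subset])
qed

definition colift :: "nat set set \<Rightarrow> nat set set" where
  "colift F = Pow {1..Suc (Suc n)} - updownset (Suc (Suc n)) (lift F)"

lemma colift_subset: "colift F \<subseteq> Pow {1..Suc (Suc n)}"
  by (auto simp: colift_def)

lemma convex_colift: "convex_family (Suc (Suc n)) (colift F)"
  unfolding colift_def by (rule convex_family_incomparable)

lemma lift_mono: "F \<subseteq> G \<Longrightarrow> lift F \<subseteq> lift G"
  by (auto simp: block_def)

lemma colift_antimono: "F \<subseteq> G \<Longrightarrow> colift G \<subseteq> colift F"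
  unfolding colift_def using updownset_mono[OF lift_mono] by blast

lemma card_colift:
  assumes "F \<subseteq> Pow {1..n}" "convex_family n F"
  shows "card (colift F) + 2 * (card (upset n F) + card (downset n F)) = 2 ^ Suc (Suc n) + card F"
proof -
  let ?N = "Suc (Suc n)"
  have "card (updownset ?N (lift F)) + card F = 2 * card (upset n F) + 2 * card (downset n F)"
    using card_updownset_convex[OF convex_lift[OF assms]]
    by (simp add: card_updownset_lift[OF assms(1)] card_block[OF assms(1)])
  moreover have sub: "updownset ?N (lift F) \<subseteq> Pow {1..?N}"
    unfolding updownset_def using upset_subset downset_subset by blast
  have "card (colift F) + card (updownset ?N (lift F)) = 2 ^ ?N"
    using card_Diff_subset[OF _ sub] card_mono[OF _ sub] unfolding colift_def
    by (simp add: card_Pow)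
  ultimately show ?thesis by simp
qed

lemma updownset_disjoint_lift:
  assumes "G \<subseteq> colift F"
  shows "updownset (Suc (Suc n)) G \<inter> lift F = {}"
proof (rule ccontr)
  assume "updownset (Suc (Suc n)) G \<inter> lift F \<noteq> {}"
  then obtain S A where S: "S \<in> lift F" "A \<in> G" "A \<subseteq> S \<or> S \<subseteq> A"
    by (auto simp: updownset_def upset_def downset_def)
  moreover have "A \<subseteq> {1..Suc (Suc n)}" using S(2) assms colift_subset by blast
  ultimately have "A \<in> updownset (Suc (Suc n)) (lift F)"
    by (auto simp: updownset_def upset_def downset_def)
  then show False using S(2) assms by (auto simp: colift_def)
qed

text \<open>
  No member of \<open>lift F\<close> is comparable to a member of \<open>G\<close>, so \<open>lift F\<close> lies outside \<open>updownset G\<close>.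
\<close>
lemma card_updownset_colift:
  assumes "G \<subseteq> colift F" "F \<subseteq> Pow {1..n}"
  shows "card (updownset (Suc (Suc n)) G) + card F \<le> 2 ^ Suc (Suc n)"
proof -
  have "card (updownset (Suc (Suc n)) G) + card (lift F) = card (updownset (Suc (Suc n)) G \<union> lift F)"
    using updownset_disjoint_lift[OF assms(1)] by (simp add: card_Un_disjoint finite_block)
  also have "updownset (Suc (Suc n)) G \<union> lift F \<subseteq> Pow {1..Suc (Suc n)}"
    unfolding updownset_def using upset_subset downset_subset block_subset by blast
  then have "card (updownset (Suc (Suc n)) G \<union> lift F) \<le> 2 ^ Suc (Suc n)"
    by (rule card_Pow_le)
  finally show ?thesis by (simp add: card_block[OF assms(2)])
qed
end

section \<open>The distinguished families\<close>

text \<open>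
  With the new elements at the two ends, lifting turns the initial segments that bound \<open>C_fam n a\<close> into
  those that bound \<open>C_fam (n + 2) a\<close>.
\<close>
interpretation lo: two_new_points n 1 "Suc (Suc n)" Suc for n
proof
  have "{1..Suc (Suc n)} = insert 1 (Suc ` {1..Suc n})"
    using image_Suc_atLeastAtMost[of 1 "Suc n"] by auto
  also have "{1..Suc n} = insert (Suc n) {1..n}" by auto
  finally show "{1..Suc (Suc n)} = insert 1 (insert (Suc (Suc n)) (Suc ` {1..n}))"
    by (simp add: insert_commute)
qed auto

text \<open>
  For colifts the picture is reflected by \<open>x \<mapsto> n + 3 - x\<close>, which exchanges the roles of the two new
  elements. The reflection moves the colifts to where they contain every lift, and is the symmetry
  that relates the definitions of \<open>C_fam\<close> and \<open>C_star_fam\<close>.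
\<close>
interpretation hi: two_new_points n "Suc (Suc n)" 1 "\<lambda>x. Suc (Suc n) - x" for n
proof
  show "inj_on ((-) (Suc (Suc n))) {1..n}" by (rule inj_onI) auto
  show "{1..Suc (Suc n)} = insert (Suc (Suc n)) (insert 1 ((-) (Suc (Suc n)) ` {1..n}))"
  proof
    show "{1..Suc (Suc n)} \<subseteq> insert (Suc (Suc n)) (insert 1 ((-) (Suc (Suc n)) ` {1..n}))"
    proof
      fix x assume x: "x \<in> {1..Suc (Suc n)}"
      show "x \<in> insert (Suc (Suc n)) (insert 1 ((-) (Suc (Suc n)) ` {1..n}))"
      proof (cases "x = 1 \<or> x = Suc (Suc n)")
        case False
        then have "x = Suc (Suc n) - (Suc (Suc n) - x)" "Suc (Suc n) - x \<in> {1..n}" using x by auto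
        then show ?thesis by blast
      qed auto
    qed
  qed auto
qed auto

text \<open>
  A set with \<open>1\<close> and without \<open>n + 2\<close> is incomparable to every set without \<open>1\<close> and with \<open>n + 2\<close>.
\<close>
lemma lo_lift_subset_hi_colift:
  assumes "G \<subseteq> Pow {1..n}"
  shows "lo.lift n F \<subseteq> hi.colift n G"
proof
  fix S assume "S \<in> lo.lift n F"
  then have "S \<subseteq> {1..Suc (Suc n)}" "1 \<in> S" "Suc (Suc n) \<notin> S"
    unfolding lo.block_def by simp_all
  then show "S \<in> hi.colift n G"
    unfolding hi.colift_def updownset_def hi.upset_lift[OF assms] hi.downset_lift[OF assms]
    unfolding hi.block_def by simp
qed

lemma upset_C_fam:
  assumes "a \<le> n"
  shows "upset n (C_fam n a) = {S. S \<subseteq> {1..n} \<and> {1..(n - a) div 2} \<subseteq> S}"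
proof (intro equalityI subsetI)
  fix S assume "S \<in> {S. S \<subseteq> {1..n} \<and> {1..(n - a) div 2} \<subseteq> S}"
  moreover have "{1..(n - a) div 2} \<in> C_fam n a" using assms by (auto simp: C_fam_def)
  ultimately show "S \<in> upset n (C_fam n a)" unfolding upset_def by blast
qed (auto simp: upset_def C_fam_def)

lemma downset_C_fam:
  assumes "a \<le> n"
  shows "downset n (C_fam n a) = {S. S \<subseteq> {1..n} \<and> S \<subseteq> {1..(n + a) div 2}}"
proof (intro equalityI subsetI)
  fix S assume "S \<in> {S. S \<subseteq> {1..n} \<and> S \<subseteq> {1..(n + a) div 2}}"
  moreover have "{1..(n + a) div 2} \<in> C_fam n a" using assms by (auto simp: C_fam_def)
  ultimately show "S \<in> downset n (C_fam n a)" unfolding downset_def by blast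
qed (auto simp: downset_def C_fam_def)

lemma lo_lift_C_fam:
  assumes "a \<le> n"
  shows "lo.lift n (C_fam n a) = C_fam (Suc (Suc n)) a"
proof -
  define k l where "k = (n - a) div 2" and "l = (n + a) div 2"
  have kl: "(Suc (Suc n) - a) div 2 = Suc k" "(Suc (Suc n) + a) div 2 = Suc l" "k \<le> n" "l \<le> n"
    using assms by (auto simp: k_def l_def Suc_diff_le)
  have low: "{1..Suc k} \<subseteq> S \<longleftrightarrow> 1 \<in> S \<and> {1..k} \<subseteq> lo.trace n S" for S
  proof -
    have "{1..Suc k} = insert 1 (Suc ` {1..k})" using image_Suc_atLeastAtMost[of 1 k] by auto
    moreover have "Suc ` {1..k} \<subseteq> S \<longleftrightarrow> {1..k} \<subseteq> lo.trace n S"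
      unfolding image_subset_iff lo.trace_def using kl(3) by auto
    ultimately show ?thesis by (simp only: insert_subset)
  qed
  have high: "S \<subseteq> {1..Suc l} \<longleftrightarrow> Suc (Suc n) \<notin> S \<and> lo.trace n S \<subseteq> {1..l}"
    if "S \<subseteq> {1..Suc (Suc n)}" for S
  proof
    assume R: "Suc (Suc n) \<notin> S \<and> lo.trace n S \<subseteq> {1..l}"
    show "S \<subseteq> {1..Suc l}"
    proof
      fix x assume x: "x \<in> S"
      then have b: "x \<in> {1..Suc (Suc n)}" "x \<noteq> Suc (Suc n)" using that R by auto
      show "x \<in> {1..Suc l}"
      proof (cases "x = 1")
        case False
        then have "x - 1 \<in> lo.trace n S" using x b by (auto simp: lo.trace_def)
        then have "x - 1 \<in> {1..l}" using R by blast
        then show ?thesis by auto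
      qed simp
    qed
  next
    assume "S \<subseteq> {1..Suc l}"
    then have "Suc x \<in> S \<Longrightarrow> x \<le> l" for x by fastforce
    then show "Suc (Suc n) \<notin> S \<and> lo.trace n S \<subseteq> {1..l}" using kl(4) by (fastforce simp: lo.trace_def)
  qed
  have "S \<in> lo.lift n (C_fam n a) \<longleftrightarrow> S \<in> C_fam (Suc (Suc n)) a" for S
  proof -
    have "S \<in> lo.lift n (C_fam n a) \<longleftrightarrow> S \<subseteq> {1..Suc (Suc n)} \<and>
        (1 \<in> S \<and> {1..k} \<subseteq> lo.trace n S) \<and> (Suc (Suc n) \<notin> S \<and> lo.trace n S \<subseteq> {1..l})"
      using lo.trace_subset[of n S] unfolding C_fam_def k_def l_def
      by (auto simp only: lo.block_def mem_Collect_eq)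
    also have "\<dots> \<longleftrightarrow> S \<in> C_fam (Suc (Suc n)) a"
      unfolding C_fam_def kl mem_Collect_eq low using high by (auto simp only:)
    finally show ?thesis .
  qed
  then show ?thesis by blast
qed

text \<open>
  A set is incomparable to the reflected lift of \<open>C_fam n a\<close> if it neither contains the bottom of this
  interval, which consists of the last \<open>(n + 2 - a) div 2\<close> elements, nor is contained in its top, whose
  complement consists of the first \<open>(n + 2 - a) div 2\<close> elements.
\<close>
lemma hi_colift_C_fam:
  assumes "a \<le> n" "[a = n] (mod 2)"
  shows "hi.colift n (C_fam n a) = C_star_fam (Suc (Suc n)) a"
proof -
  define k l where "k = (n - a) div 2" and "l = (n + a) div 2"
  have "even (n - a)" using assms by (simp add: cong_def even_diff_nat) presburger
  then have "n - a = 2 * k" by (simp add: k_def)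
  moreover from this have "n + a = 2 * (k + a)" using assms(1) by simp
  ultimately have n: "n = k + l" unfolding l_def using assms(1) by simp
  have kl: "(Suc (Suc n) - a) div 2 = Suc k" "(Suc (Suc n) + a) div 2 = Suc l"
    using assms by (auto simp: k_def l_def Suc_diff_le)
  have C: "C_fam n a \<subseteq> Pow {1..n}" by (auto simp: C_fam_def)
  have up: "{Suc l + 1..Suc (Suc n)} \<subseteq> S \<longleftrightarrow> Suc (Suc n) \<in> S \<and> {1..k} \<subseteq> hi.trace n S" for S
  proof
    assume S: "{Suc l + 1..Suc (Suc n)} \<subseteq> S"
    have "Suc (Suc n) - x \<in> {Suc l + 1..Suc (Suc n)}" if "x \<in> {1..k}" for x
      using that n by auto
    then show "Suc (Suc n) \<in> S \<and> {1..k} \<subseteq> hi.trace n S"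
      using S n by (auto simp: hi.trace_def)
  next
    assume R: "Suc (Suc n) \<in> S \<and> {1..k} \<subseteq> hi.trace n S"
    show "{Suc l + 1..Suc (Suc n)} \<subseteq> S"
    proof
      fix x assume x: "x \<in> {Suc l + 1..Suc (Suc n)}"
      show "x \<in> S"
      proof (cases "x = Suc (Suc n)")
        case False
        then have "Suc (Suc n) - x \<in> {1..k}" using x n by auto
        then have "Suc (Suc n) - x \<in> hi.trace n S" using R by blast
        then show ?thesis using x by (simp add: hi.trace_def)
      qed (use R in simp)
    qed
  qed
  have down: "S \<subseteq> {Suc k + 1..Suc (Suc n)} \<longleftrightarrow> 1 \<notin> S \<and> hi.trace n S \<subseteq> {1..l}"
    if S: "S \<subseteq> {1..Suc (Suc n)}" for S
  proof
    assume sub: "S \<subseteq> {Suc k + 1..Suc (Suc n)}"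
    have "x \<in> {1..l}" if "x \<in> hi.trace n S" for x
    proof -
      have "x \<in> {1..n}" "Suc (Suc n) - x \<in> {Suc k + 1..Suc (Suc n)}"
        using that sub by (auto simp: hi.trace_def)
      then show ?thesis using n by auto
    qed
    moreover have "1 \<notin> S" using sub by fastforce
    ultimately show "1 \<notin> S \<and> hi.trace n S \<subseteq> {1..l}" by blast
  next
    assume R: "1 \<notin> S \<and> hi.trace n S \<subseteq> {1..l}"
    show "S \<subseteq> {Suc k + 1..Suc (Suc n)}"
    proof
      fix x assume x: "x \<in> S"
      then have b: "x \<in> {1..Suc (Suc n)}" "x \<noteq> 1" using S R by auto
      show "x \<in> {Suc k + 1..Suc (Suc n)}"
      proof (cases "x = Suc (Suc n)")
        case False
        then have "Suc (Suc n) - x \<in> hi.trace n S" using x b by (auto simp: hi.trace_def)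
        then have "Suc (Suc n) - x \<in> {1..l}" using R by blast
        then show ?thesis using b n by auto
      qed (use n in simp)
    qed
  qed
  have "S \<in> hi.colift n (C_fam n a) \<longleftrightarrow> S \<in> C_star_fam (Suc (Suc n)) a" for S
  proof -
    have "S \<in> hi.colift n (C_fam n a) \<longleftrightarrow> S \<subseteq> {1..Suc (Suc n)} \<and>
        \<not> (Suc (Suc n) \<in> S \<and> {1..k} \<subseteq> hi.trace n S) \<and> \<not> (1 \<notin> S \<and> hi.trace n S \<subseteq> {1..l})"
      unfolding hi.colift_def updownset_def hi.upset_lift[OF C] hi.downset_lift[OF C]
        upset_C_fam[OF assms(1)] downset_C_fam[OF assms(1)] k_def l_def
      using hi.trace_subset[of n S] by (auto simp only: hi.block_def mem_Collect_eq Diff_iff Un_iff Pow_iff)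
    also have "\<dots> \<longleftrightarrow> S \<in> C_star_fam (Suc (Suc n)) a"
      unfolding C_star_fam_def kl mem_Collect_eq up using down by (auto simp only:)
    finally show ?thesis .
  qed
  then show ?thesis by blast
qed

section \<open>Optimal flags\<close>

text \<open>
  The optimality statement that goes through the induction. It is purely numerical on the side of
  the competitors: the closures of \<open>F\<close> are compared with all pairs \<open>(u, d)\<close> that \<open>lexmeet\<close> permits, be they
  realised by families or not.
\<close>
definition tight :: "nat \<Rightarrow> nat \<Rightarrow> nat set set \<Rightarrow> bool" where
  "tight n m F \<longleftrightarrow> (\<forall>u d. u \<le> 2 ^ n \<longrightarrow> d \<le> 2 ^ n \<longrightarrow> m \<le> lexmeet n u d \<longrightarrow>
     card (upset n F) + card (downset n F) \<le> u + d)"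

definition optimal_flag :: "nat \<Rightarrow> (nat \<Rightarrow> nat set set) \<Rightarrow> bool" where
  "optimal_flag n F \<longleftrightarrow> flag n F \<and> (\<forall>m \<le> 2 ^ n. tight n m (F m)) \<and>
     (\<forall>a \<le> n. [a = n] (mod 2) \<longrightarrow> C_fam n a \<in> F ` {0..2 ^ n}) \<and>
     (\<forall>a. a + 2 \<le> n \<and> [a = n] (mod 2) \<longrightarrow> C_star_fam n a \<in> F ` {0..2 ^ n})"

lemma flagD:
  assumes "flag n F" "m \<le> 2 ^ n"
  shows "F m \<subseteq> Pow {1..n}" "convex_family n (F m)" "card (F m) = m" "finite (F m)"
proof -
  show "F m \<subseteq> Pow {1..n}" "convex_family n (F m)" "card (F m) = m"
    using assms by (simp_all add: flag_def)
  then show "finite (F m)" using finite_subset[of "F m" "Pow {1..n}"] by simp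
qed

lemma flag_top: "flag n F \<Longrightarrow> F (2 ^ n) = Pow {1..n}"
  using flagD[of n F "2 ^ n"] by (intro card_subset_eq) (simp_all add: card_Pow)

lemma C_fam_eq_Pow: "C_fam n n = Pow {1..n}"
  by (auto simp: C_fam_def)

text \<open>
  For \<open>n \<le> 1\<close> every flag is optimal: a family of \<open>m > 0\<close> sets has closures of total size at most
  \<open>m + 2 ^ n\<close>, and no permitted pair \<open>(u, d)\<close> has a smaller sum.
\<close>
lemma optimal_flag_small:
  assumes "n \<le> 1"
  shows "\<exists>F. optimal_flag n F"
proof -
  obtain F where F: "flag n F" using flag_through_chain[of "{}" n] by blast
  have "tight n m (F m)" if m: "m \<le> 2 ^ n" for m
    unfolding tight_def
  proof (intro allI impI)
    fix u d assume ud: "u \<le> 2 ^ n" "d \<le> 2 ^ n" "m \<le> lexmeet n u d"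
    show "card (upset n (F m)) + card (downset n (F m)) \<le> u + d"
    proof (cases "m = 0")
      case True
      then have "F m = {}" using flagD[OF F m] by simp
      then show ?thesis by (simp add: upset_def downset_def)
    next
      case False
      have "card (upset n (F m)) + card (downset n (F m)) = m + card (updownset n (F m))"
        using card_updownset_convex[of n "F m"] flagD[OF F m] by simp
      also have "\<dots> \<le> m + 2 ^ n" using card_Pow_le[OF updownset_subset] by simp
      also have "\<dots> \<le> u + d"
      proof (cases "n = 0")
        case True
        then show ?thesis using ud m False by simp
      next
        case n: False
        then have "n = 1" using assms by simp
        then have "u \<in> {0,1,2}" "d \<in> {0,1,2}" using ud by auto
        then show ?thesis using ud(3) False \<open>n = 1\<close> by (auto simp: lexmeet.simps(2) split: if_splits)
      qed
      finally show ?thesis .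
    qed
  qed
  moreover have "C_fam n a \<in> F ` {0..2 ^ n}" if "a \<le> n" "[a = n] (mod 2)" for a
  proof -
    have "a = n" using that assms by (auto simp: cong_def le_Suc_eq)
    then show ?thesis using flag_top[OF F] by (auto simp: C_fam_eq_Pow intro!: image_eqI[of _ F "2 ^ n"])
  qed
  ultimately show ?thesis using F assms unfolding optimal_flag_def by (intro exI[of _ F]) auto
qed

text \<open>
  A flag through all lifts and colifts of the given one. Members with at most \<open>2 ^ n\<close> sets are lifts,
  and are optimal by halving. A larger member of size \<open>m\<close> lies in a colift \<open>G t\<close>; take \<open>t\<close> as large as
  possible. Then at least \<open>t\<close> sets are incomparable to all its members, and a competitor that does
  better would have at least \<open>t + 1\<close> such sets; its complement would be a competitor to the lift of
  \<open>F' (t + 1)\<close>, whose optimality then forces \<open>G (t + 1)\<close> to have \<open>m\<close> members, contrary to the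
  choice of \<open>t\<close>.
\<close>
lemma optimal_flag_step:
  assumes "optimal_flag n F'"
  shows "\<exists>F. optimal_flag (Suc (Suc n)) F"
proof -
  let ?N = "Suc (Suc n)" and ?Q = "2 ^ n :: nat"
  have flag': "flag n F'" and tight': "\<And>m. m \<le> ?Q \<Longrightarrow> tight n m (F' m)"
    and C': "\<And>a. a \<le> n \<Longrightarrow> [a = n] (mod 2) \<Longrightarrow> C_fam n a \<in> F' ` {0..?Q}"
    using assms by (simp_all add: optimal_flag_def)
  note sub' = flagD(1)[OF flag'] and conv' = flagD(2)[OF flag'] and card' = flagD(3)[OF flag']
  define L where "L t = lo.lift n (F' t)" for t
  define G where "G t = hi.colift n (F' t)" for t
  have L: "L t \<subseteq> Pow {1..?N}" "convex_family ?N (L t)" "card (L t) = t" if "t \<le> ?Q" for t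
    using lo.block_subset lo.convex_lift[OF sub'[OF that] conv'[OF that]]
      lo.card_block[OF sub'[OF that]] card'[OF that] by (simp_all add: L_def)
  have cardG: "card (G t) + 2 * (card (upset n (F' t)) + card (downset n (F' t))) = 4 * ?Q + t"
    if "t \<le> ?Q" for t
    using hi.card_colift[OF sub'[OF that] conv'[OF that]] card'[OF that] by (simp add: G_def)
  have L_mono: "L s \<subseteq> L t" if "s \<le> t" "t \<le> ?Q" for s t
    unfolding L_def by (rule lo.lift_mono[OF flag_mono[OF flag' that]])
  have G_mono: "G t \<subseteq> G s" if "s \<le> t" "t \<le> ?Q" for s t
    unfolding G_def by (rule hi.colift_antimono[OF flag_mono[OF flag' that]])
  have LG: "L s \<subseteq> G t" if "t \<le> ?Q" for s t
    unfolding L_def G_def by (rule lo_lift_subset_hi_colift[OF sub'[OF that]])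
  let ?S = "L ` {0..?Q} \<union> G ` {0..?Q}"
  have "\<exists>F. flag ?N F \<and> (\<forall>X\<in>?S. F (card X) = X)"
  proof (rule flag_through_chain)
    fix X assume "X \<in> ?S"
    then consider t where "t \<le> ?Q" "X = L t" | t where "t \<le> ?Q" "X = G t" by auto
    then show "X \<subseteq> Pow {1..?N} \<and> convex_family ?N X"
    proof cases
      case 2
      then show ?thesis using hi.colift_subset hi.convex_colift by (simp add: G_def)
    qed (use L in simp)
  next
    fix X Y assume "X \<in> ?S" "Y \<in> ?S"
    then consider s t where "s \<le> ?Q" "t \<le> ?Q" "X = L s" "Y = L t"
      | s t where "s \<le> ?Q" "t \<le> ?Q" "X = L s" "Y = G t"
      | s t where "s \<le> ?Q" "t \<le> ?Q" "X = G s" "Y = L t"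
      | s t where "s \<le> ?Q" "t \<le> ?Q" "X = G s" "Y = G t"
      by fastforce
    then show "X \<subseteq> Y \<or> Y \<subseteq> X"
    proof cases
      case 1
      then show ?thesis using L_mono[of s t] L_mono[of t s] nat_le_linear[of s t] by blast
    next
      case 4
      then show ?thesis using G_mono[of s t] G_mono[of t s] nat_le_linear[of s t] by blast
    qed (use LG in blast)+
  qed
  then obtain F where "flag ?N F \<and> (\<forall>X\<in>?S. F (card X) = X)" by (rule exE)
  then have F: "flag ?N F" and FS: "\<And>X. X \<in> ?S \<Longrightarrow> F (card X) = X" by simp_all
  have FL: "F t = L t" if "t \<le> ?Q" for t
    using FS[of "L t"] L(3)[OF that] that by auto
  have FG: "F (card (G t)) = G t" "card (G t) \<le> 2 ^ ?N" if "t \<le> ?Q" for t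
    using FS[of "G t"] that card_Pow_le[OF hi.colift_subset] by (auto simp: G_def)
  have bound: "2 * (card (upset n (F' t)) + card (downset n (F' t))) \<le> u + d"
    if t: "t \<le> ?Q" "t \<le> lexmeet ?N u d" "u \<le> 2 ^ ?N" "d \<le> 2 ^ ?N" for t u d
  proof -
    obtain u' d' where h: "u' \<le> ?Q" "d' \<le> ?Q" "t \<le> lexmeet n u' d'" "2 * (u' + d') \<le> u + d"
      using lexmeet_halve[OF t] by blast
    then have "card (upset n (F' t)) + card (downset n (F' t)) \<le> u' + d'"
      using tight'[OF t(1)] by (simp add: tight_def)
    then show ?thesis using h(4) by simp
  qed
  have tight: "tight ?N m (F m)" if m: "m \<le> 2 ^ ?N" for m
    unfolding tight_def
  proof (intro allI impI)
    fix u d assume u: "u \<le> 2 ^ ?N" and d: "d \<le> 2 ^ ?N" and meet: "m \<le> lexmeet ?N u d"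
    show "card (upset ?N (F m)) + card (downset ?N (F m)) \<le> u + d"
    proof (cases "m \<le> ?Q")
      case True
      show ?thesis
        using bound[OF True meet u d]
        unfolding FL[OF True] L_def lo.card_updownset_lift[OF sub'[OF True]] by simp
    next
      case False
      define t where "t = Max {t. t \<le> ?Q \<and> m \<le> card (G t)}"
      let ?T = "{t. t \<le> ?Q \<and> m \<le> card (G t)}"
      have "F' 0 = {}" using flagD[OF flag', of 0] by simp
      then have "card (G 0) = 4 * ?Q" using cardG[of 0] by (simp add: upset_def downset_def)
      then have "0 \<in> ?T" using m by simp
      then have T: "finite ?T" "?T \<noteq> {}" by auto
      have t: "t \<le> ?Q" "m \<le> card (G t)" using Max_in[OF T] by (simp_all add: t_def)
      have "card (G ?Q) \<le> ?Q"
      proof -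
        have "upset n (Pow {1..n}) = Pow {1..n}" "downset n (Pow {1..n}) = Pow {1..n}"
          by (auto simp: upset_def downset_def)
        then show ?thesis using cardG[of ?Q] by (simp add: flag_top[OF flag'] card_Pow)
      qed
      then have "t \<noteq> ?Q" using t False by auto
      then have t1: "Suc t \<le> ?Q" using t by simp
      have G1: "card (G (Suc t)) < m"
      proof (rule ccontr)
        assume "\<not> card (G (Suc t)) < m"
        then have "Suc t \<in> ?T" using t1 by simp
        then have "Suc t \<le> t" unfolding t_def using T(1) by (intro Max_ge)
        then show False by simp
      qed
      have "F m \<subseteq> G t" using flag_mono[OF F t(2) FG(2)[OF t(1)]] FG(1)[OF t(1)] by simp
      then have "card (updownset ?N (F m)) + t \<le> 4 * ?Q"
        using hi.card_updownset_colift[of "F m" n "F' t"] sub'[OF t(1)] card'[OF t(1)] by (simp add: G_def)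
      then have upper: "card (upset ?N (F m)) + card (downset ?N (F m)) + t \<le> 4 * ?Q + m"
        using card_updownset_convex[of ?N "F m"] flagD[OF F m] by simp
      show ?thesis
      proof (rule ccontr)
        assume "\<not> ?thesis"
        then have less: "u + d + t < 4 * ?Q + m" using upper by simp
        \<comment> \<open>Enlarge the competitor until its sum is exactly one less than the bound; the overlap can only grow.\<close>
        define v where "v = min (2 ^ ?N) (4 * ?Q + m - t - 1 - d)"
        define e where "e = 4 * ?Q + m - t - 1 - v"
        have ve: "u \<le> v" "d \<le> e" "v \<le> 4 * ?Q" "e \<le> 4 * ?Q" "v + e + t + 1 = 4 * ?Q + m"
          using less u d m t1 unfolding v_def e_def by (auto simp: min_def)
        \<comment> \<open>The complementary competitor overlaps in at least \<open>t + 1\<close>.\<close>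
        have "m \<le> lexmeet ?N v e" using meet lexmeet_mono[OF ve(1,2)] order_trans by blast
        moreover have "lexmeet ?N (2 ^ ?N - v) (2 ^ ?N - e) + v + e = 2 ^ ?N + lexmeet ?N v e"
          using ve by (intro lexmeet_complement) auto
        ultimately have "Suc t \<le> lexmeet ?N (2 ^ ?N - v) (2 ^ ?N - e)" using ve(5) by simp
        then have "2 * (card (upset n (F' (Suc t))) + card (downset n (F' (Suc t))))
            \<le> (2 ^ ?N - v) + (2 ^ ?N - e)"
          using t1 by (intro bound) auto
        then show False using cardG[OF t1] G1 ve by simp
      qed
    qed
  qed
  have C: "C_fam ?N a \<in> F ` {0..2 ^ ?N}" if "a \<le> ?N" "[a = ?N] (mod 2)" for a
  proof (cases "a \<le> n")
    case True
    have "[a = n] (mod 2)" using that(2) by (simp add: cong_def)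
    then obtain t where t: "t \<le> ?Q" "C_fam n a = F' t" using C'[OF True] by auto
    have "F t = C_fam ?N a" unfolding FL[OF t(1)] L_def t(2)[symmetric] by (rule lo_lift_C_fam[OF True])
    then show ?thesis using t(1) by auto
  next
    case False
    have "a \<noteq> Suc n" using that(2) by (auto simp: cong_def) presburger
    then have "a = ?N" using False that(1) by simp
    then show ?thesis using flag_top[OF F] by (auto simp: C_fam_eq_Pow intro!: image_eqI[of _ F "2 ^ ?N"])
  qed
  have C_star: "C_star_fam ?N a \<in> F ` {0..2 ^ ?N}" if "a + 2 \<le> ?N \<and> [a = ?N] (mod 2)" for a
  proof -
    have a: "a \<le> n" "[a = n] (mod 2)" using that by (simp_all add: cong_def)
    then obtain t where t: "t \<le> ?Q" "C_fam n a = F' t" using C'[OF a] by auto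
    have "G t = C_star_fam ?N a" unfolding G_def t(2)[symmetric] by (rule hi_colift_C_fam[OF a])
    then have "C_star_fam ?N a = F (card (G t))" using FG(1)[OF t(1)] by simp
    then show ?thesis using FG(2)[OF t(1)] by auto
  qed
  have "optimal_flag ?N F"
    unfolding optimal_flag_def by (intro conjI allI impI F tight C C_star) simp_all
  then show ?thesis by (intro exI[of _ F])
qed

lemma optimal_flag_exists: "\<exists>F. optimal_flag n F"
proof (induction n rule: less_induct)
  case (less n)
  show ?case
  proof (cases "n \<le> 1")
    case False
    then obtain k where n: "n = Suc (Suc k)" by (metis One_nat_def Suc_le_mono le0 nat.exhaust)
    then obtain F where "optimal_flag k F" using less[of k] by auto
    then show ?thesis unfolding n by (rule optimal_flag_step)
  qed (rule optimal_flag_small)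
qed

lemma upset_idem: "upset n (upset n H) = upset n H"
proof (intro equalityI subsetI)
  fix S assume "S \<in> upset n (upset n H)"
  then obtain A B where "S \<subseteq> {1..n}" "A \<subseteq> S" "B \<in> H" "B \<subseteq> A" by (auto simp: upset_def)
  then show "S \<in> upset n H" using order_trans[of B A S] by (auto simp: upset_def)
qed (auto simp: upset_def)

lemma downset_idem: "downset n (downset n H) = downset n H"
proof (intro equalityI subsetI)
  fix S assume "S \<in> downset n (downset n H)"
  then obtain A B where "S \<subseteq> {1..n}" "S \<subseteq> A" "B \<in> H" "A \<subseteq> B" by (auto simp: downset_def)
  then show "S \<in> downset n H" using order_trans[of S A B] by (auto simp: downset_def)
qed (auto simp: downset_def)

text \<open>
  Since \<open>H\<close> need not be convex, the intersection of its closures has \<open>x \<ge> card H\<close> members; comparing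
  with \<open>F x\<close> is enough, because the comparable sets of the members of a flag increase.
\<close>
lemma card_updownset_tight_le:
  assumes F: "flag n F" and tight: "\<And>m. m \<le> 2 ^ n \<Longrightarrow> tight n m (F m)"
    and H: "H \<subseteq> Pow {1..n}"
  shows "card (updownset n (F (card H))) \<le> card (updownset n H)"
proof -
  define x where "x = card (upset n H \<inter> downset n H)"
  have meet: "x \<le> lexmeet n (card (upset n H)) (card (downset n H))"
    unfolding x_def by (rule card_upset_Int_downset_le[OF upset_idem downset_idem])
  have x: "x \<le> 2 ^ n" unfolding x_def using upset_subset by (intro card_Pow_le) blast
  have "card H \<le> x"
    unfolding x_def by (intro card_mono subset_upset_Int_downset H) simp
  then have "F (card H) \<subseteq> F x" using flag_mono[OF F _ x] by blast
  then have "card (updownset n (F (card H))) \<le> card (updownset n (F x))"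
    by (intro card_mono updownset_mono) simp
  also have "card (updownset n (F x)) + x \<le> card (upset n H) + card (downset n H)"
    using tight[OF x] meet card_Pow_le[OF upset_subset] card_Pow_le[OF downset_subset]
      card_updownset_convex[of n "F x"] flagD[OF F x] by (simp add: tight_def)
  then have "card (updownset n (F x)) \<le> card (updownset n H)"
    using card_updownset[of n H] by (simp add: x_def)
  finally show ?thesis .
qed

lemma Phi_eq:
  assumes "flag n F" "\<And>m. m \<le> 2 ^ n \<Longrightarrow> tight n m (F m)" "m \<le> 2 ^ n"
  shows "card (updownset n (F m)) = Phi n m"
proof -
  let ?V = "{card (updownset n H) | H. H \<subseteq> Pow {1..n} \<and> card H = m}"
  have "?V \<subseteq> (\<lambda>H. card (updownset n H)) ` Pow (Pow {1..n})" by auto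
  then have "finite ?V" by (rule finite_subset) simp
  moreover have "card (updownset n (F m)) \<in> ?V" using flagD[OF assms(1,3)] by blast
  moreover have "card (updownset n (F m)) \<le> v" if "v \<in> ?V" for v
    using that card_updownset_tight_le[OF assms(1,2)] by auto
  ultimately show ?thesis unfolding Phi_def by (intro Min_eqI[symmetric])
qed

theorem theorem1p4:
  fixes n :: nat
  shows "\<exists>F :: nat \<Rightarrow> nat set set.
           (\<forall>m \<le> 2 ^ n. F m \<subseteq> Pow {1..n} \<and> convex_family n (F m)
                         \<and> card (F m) = m \<and> card (updownset n (F m)) = Phi n m) \<and>
           (\<forall>m < 2 ^ n. F m \<subset> F (Suc m)) \<and>
           (\<forall>a. a + 2 \<le> n \<and> [a = n] (mod 2) \<longrightarrow>
              C_fam n a \<in> F ` {0..2 ^ n} \<and> C_star_fam n a \<in> F ` {0..2 ^ n})"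
proof -
  obtain F where "optimal_flag n F" using optimal_flag_exists by blast
  then have F: "flag n F" and tight: "\<And>m. m \<le> 2 ^ n \<Longrightarrow> tight n m (F m)"
    and C: "\<And>a. a \<le> n \<Longrightarrow> [a = n] (mod 2) \<Longrightarrow> C_fam n a \<in> F ` {0..2 ^ n}"
    and C_star: "\<And>a. a + 2 \<le> n \<and> [a = n] (mod 2) \<Longrightarrow> C_star_fam n a \<in> F ` {0..2 ^ n}"
    by (simp_all add: optimal_flag_def)
  show ?thesis
  proof (intro exI[of _ F] conjI allI impI)
    fix m :: nat assume m: "m \<le> 2 ^ n"
    show "F m \<subseteq> Pow {1..n}" "convex_family n (F m)" "card (F m) = m"
      using flagD[OF F m] by simp_all
    show "card (updownset n (F m)) = Phi n m" by (rule Phi_eq[OF F tight m])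
  next
    fix m :: nat assume "m < 2 ^ n"
    then show "F m \<subset> F (Suc m)" using F by (simp add: flag_def)
  next
    fix a assume a: "a + 2 \<le> n \<and> [a = n] (mod 2)"
    then show "C_fam n a \<in> F ` {0..2 ^ n}" by (intro C) auto
    show "C_star_fam n a \<in> F ` {0..2 ^ n}" by (rule C_star[OF a])
  qed
qed

end
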